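(* Let $k=pq$ be the product of two distinct Blum primes $p$ and $q$, i.e. primes congruent to $3$ modulo $4$. Let $\psi_1,\psi_2$ be integers with $\psi_1\equiv 1 \bmod p$, $\psi_1\equiv 0 \bmod q$, $\psi_2\equiv 0\bmod p$, $\psi_2\equiv 1\bmod q$. Let $x_1$ be an integer with $\gcd(x_1,k)=1$ and let $x_2=x_1(\psi_1-\psi_2)$. Then $$s(x_1,k)+s(x_2,k)\equiv 1 \bmod 2 .$$
   Context: For relatively prime integers $h,k$ with $k\ge 1$, the Dedekind sum is $s(h,k)=\sum_{j=1}^{k}\left(\left(\frac{hj}{k}\right)\right)\left(\left(\frac{j}{k}\right)\right)$, where $((x))=x-\lfloor x\rfloor-\frac12$ if $x$ is not an integer and $((x))=0$ if $x$ is an integer. Since $k\equiv 1 \bmod 4$, the rational numbers $s(x_1,k)$ and $s(x_2,k)$ have odd denominators, and the congruence modulo $2$ is understood in the ring of rational numbers with odd denominator: $a\equiv b \bmod 2$ means that $(a-b)/2$ has odd denominator. *)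

theory Defs
  imports "HOL-Number_Theory.Number_Theory"
begin

definition sawtooth :: "rat \<Rightarrow> rat" where
  "sawtooth x = (if x \<in> \<int> then 0 else x - of_int \<lfloor>x\<rfloor> - 1 / 2)"

definition dedekind_sum :: "int \<Rightarrow> int \<Rightarrow> rat" where
  "dedekind_sum h k =
     (\<Sum>j = 1..k. sawtooth (of_int (h * j) / of_int k) * sawtooth (of_int j / of_int k))"

definition blum_prime :: "int \<Rightarrow> bool" where
  "blum_prime p \<longleftrightarrow> prime p \<and> [p = 3] (mod 4)"

definition odd_denominator :: "rat \<Rightarrow> bool" where
  "odd_denominator x \<longleftrightarrow> odd (snd (quotient_of x))"

text \<open>Congruence modulo 2 in the ring of rational numbers with odd denominator.\<close>

definition rat_cong2 :: "rat \<Rightarrow> rat \<Rightarrow> bool" where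
  "rat_cong2 a b \<longleftrightarrow> odd_denominator ((a - b) / 2)"

lemma odd_denominator_divideI:
  assumes "odd b"
  shows "odd_denominator (of_int a / of_int b)"
proof -
  obtain c d where q: "quotient_of (of_int a / of_int b) = (c, d)"
    by (cases "quotient_of (of_int a / of_int b)") auto
  have d: "d > 0" and cd: "coprime c d"
    using quotient_of_denom_pos[OF q] quotient_of_coprime[OF q] by auto
  have "of_int a / of_int b = (of_int c / of_int d :: rat)"
    using quotient_of_div[OF q] .
  moreover have "b \<noteq> 0" using assms by auto
  ultimately have "(of_int (a * d) :: rat) = of_int (c * b)"
    using d by (simp add: field_simps)
  then have "a * d = c * b" by (simp only: of_int_eq_iff)
  then have "d dvd c * b" by (metis dvd_triv_right)
  then have "d dvd b" using cd by (simp add: coprime_commute coprime_dvd_mult_right_iff)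
  then have "odd d" using assms dvd_trans by blast
  then show ?thesis by (simp add: odd_denominator_def q)
qed

lemma sawtooth_of_int_divide:
  fixes a k :: int
  assumes "k > 0"
  shows "sawtooth (of_int a / of_int k) =
    (if k dvd a then 0 else of_int (2 * (a mod k) - k) / of_int (2 * k))"
proof (cases "k dvd a")
  case True
  then show ?thesis using assms by (auto simp: sawtooth_def elim!: dvdE)
next
  case False
  have "(of_int a / of_int k :: rat) \<notin> \<int>"
  proof
    assume "(of_int a / of_int k :: rat) \<in> \<int>"
    then obtain c where "(of_int a / of_int k :: rat) = of_int c" by (auto elim: Ints_cases)
    then have "(of_int a :: rat) = of_int (c * k)" using assms by (simp add: field_simps)
    then have "a = c * k" by (simp only: of_int_eq_iff)
    then show False using False by simp
  qed
  moreover have "(of_int a :: rat) = of_int (a div k) * of_int k + of_int (a mod k)"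
    by (metis div_mult_mod_eq of_int_add of_int_mult)
  moreover have "\<lfloor>of_int a / of_int k :: rat\<rfloor> = a div k"
    by (rule floor_divide_of_int_eq)
  ultimately have "sawtooth (of_int a / of_int k) = of_int a / of_int k - of_int (a div k) - 1 / 2"
    by (simp only: sawtooth_def if_False)
  also have "\<dots> = of_int (2 * (a mod k) - k) / of_int (2 * k)"
    using assms \<open>of_int a = _\<close> by (simp add: field_simps)
  finally show ?thesis using False by simp
qed

lemma odd_denominator_dedekind_sum:
  fixes h k :: int
  assumes "k \<ge> 1" "coprime h k" "[k = 1] (mod 4)"
  shows "odd_denominator (dedekind_sum h k)"
proof -
  define r where "r j = (h * j) mod k" for j
  define S where "S = (\<Sum>j\<in>{1..<k}. r j * j)"
  define T where "T = \<Sum>{1..<k}"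
  have ndvd: "\<not> k dvd h * j" "\<not> k dvd j" if "j \<in> {1..<k}" for j
    using that assms zdvd_not_zless[of j k]
    by (auto simp: coprime_commute coprime_dvd_mult_right_iff)
  have "inj_on r {1..<k}"
  proof (rule inj_onI)
    fix i j assume ij: "i \<in> {1..<k}" "j \<in> {1..<k}" "r i = r j"
    then have "[h * i = h * j] (mod k)" by (simp add: r_def cong_def)
    then have "[i = j] (mod k)" using assms cong_mult_lcancel by blast
    then show "i = j" using ij by (simp add: cong_def)
  qed
  moreover have "r ` {1..<k} \<subseteq> {1..<k}"
  proof
    fix y assume "y \<in> r ` {1..<k}"
    then obtain j where j: "j \<in> {1..<k}" "y = r j" by auto
    have "r j \<noteq> 0" using ndvd(1)[OF j(1)] by (auto simp: r_def)
    moreover have "0 \<le> r j" "r j < k" using assms(1) by (auto simp: r_def)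
    ultimately show "y \<in> {1..<k}" using j by auto
  qed
  ultimately have "bij_betw r {1..<k} {1..<k}"
    by (simp add: bij_betw_def endo_inj_surj)
  then have sum_r: "(\<Sum>j\<in>{1..<k}. r j) = T"
    unfolding T_def by (rule sum.reindex_bij_betw[where g = "\<lambda>x. x", simplified])
  obtain m where m: "k = 4 * m + 1"
    using assms(3) by (metis cong_iff_lin cong_sym add.commute mult.commute)
  have "dedekind_sum h k = (\<Sum>j\<in>{1..<k}.
      sawtooth (of_int (h * j) / of_int k) * sawtooth (of_int j / of_int k))"
    unfolding dedekind_sum_def using assms(1)
    by (intro sum.mono_neutral_right) (auto simp: sawtooth_def)
  also have "\<dots> = (\<Sum>j\<in>{1..<k}. of_int ((2 * r j - k) * (2 * j - k)) / of_int (4 * k\<^sup>2))"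
  proof (rule sum.cong[OF refl])
    fix j assume j: "j \<in> {1..<k}"
    then show "sawtooth (of_int (h * j) / of_int k) * sawtooth (of_int j / of_int k) =
        of_int ((2 * r j - k) * (2 * j - k)) / of_int (4 * k\<^sup>2)"
      using ndvd[OF j] assms(1) sawtooth_of_int_divide[of k "h * j"] sawtooth_of_int_divide[of k j]
      by (simp add: r_def power2_eq_square)
  qed
  also have "\<dots> = of_int (\<Sum>j\<in>{1..<k}. (2 * r j - k) * (2 * j - k)) / of_int (4 * k\<^sup>2)"
    by (simp add: sum_divide_distrib)
  also have "(\<Sum>j\<in>{1..<k}. (2 * r j - k) * (2 * j - k)) =
      (\<Sum>j\<in>{1..<k}. 4 * (r j * j) - 2 * k * r j - 2 * k * j + k\<^sup>2)"
    by (intro sum.cong) (auto simp: algebra_simps power2_eq_square)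
  also have "\<dots> = 4 * S - 2 * k * T - 2 * k * T + (k - 1) * k\<^sup>2"
    using assms(1)
    by (simp add: sum.distrib sum_subtractf sum_r S_def T_def flip: sum_distrib_left)
  also have "\<dots> = 4 * (S - k * T + m * k\<^sup>2)"
    by (simp add: m algebra_simps)
  also have "(of_int \<dots> :: rat) / of_int (4 * k\<^sup>2) = of_int (S - k * T + m * k\<^sup>2) / of_int (k\<^sup>2)"
    by (simp only: of_int_mult mult_divide_mult_cancel_left)
  finally have "dedekind_sum h k = of_int (S - k * T + m * k\<^sup>2) / of_int (k\<^sup>2)" .
  moreover have "odd (k\<^sup>2)" by (simp add: m)
  ultimately show ?thesis by (metis odd_denominator_divideI)
qed

end

theory Submission
  imports Defs
begin

text \<open>
  Multiplying by \<open>k\<^sup>2\<close>, the parity of \<open>s(h, k)\<close> for \<open>k \<equiv> 1 (mod 4)\<close> is, up to a summand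
  that is independent of \<open>h\<close>, the parity of \<open>S(h) = \<Sum>j. j (h j mod k)\<close>, where \<open>0 < j < k\<close>.
  Let \<open>u = \<psi>1 - \<psi>2\<close>, so that \<open>u\<^sup>2 \<equiv> 1 (mod k)\<close>, and put \<open>a = j\<close>, \<open>b = x1 j mod k\<close>,
  \<open>c = u j mod k\<close>. Then \<open>S(x1)\<close>, \<open>S(u)\<close>, \<open>S(x2)\<close> are the sums of \<open>a b\<close>, \<open>a c\<close>, \<open>b c\<close>, and
  \<open>j \<mapsto> k - j\<close> flips the parities of \<open>a\<close>, \<open>b\<close>, \<open>c\<close>, hence that of the majority
  function \<open>a b + a c + b c\<close>; so the three sums add up to \<open>(k - 1) / 2 \<equiv> 0 (mod 2)\<close>.
  Finally \<open>S(u)\<close> is odd: in it the involution \<open>j \<mapsto> u j mod k\<close> cancels everything but its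
  fixed points, the multiples of \<open>q\<close>, of which \<open>(p - 1) / 2\<close> are odd.
\<close>

definition residue_sum :: "int \<Rightarrow> int \<Rightarrow> int" where
  "residue_sum h k = (\<Sum>j\<in>{1..<k}. j * (h * j mod k))"

lemma bij_betw_mult_mod:
  fixes h k :: int
  assumes "coprime h k"
  shows "bij_betw (\<lambda>j. h * j mod k) {1..<k} {1..<k}"
proof -
  have "inj_on (\<lambda>j. h * j mod k) {1..<k}"
  proof (rule inj_onI)
    fix i j assume ij: "i \<in> {1..<k}" "j \<in> {1..<k}" "h * i mod k = h * j mod k"
    then have "[i = j] (mod k)" using assms cong_mult_lcancel[of h k] by (simp add: cong_def)
    then show "i = j" using ij by (simp add: cong_def)
  qed
  moreover have "h * j mod k \<in> {1..<k}" if "j \<in> {1..<k}" for j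
  proof -
    have "\<not> k dvd h * j"
      using that assms zdvd_not_zless[of j k]
      by (auto simp: coprime_commute coprime_dvd_mult_right_iff)
    moreover have "0 \<le> h * j mod k" "h * j mod k < k" using that by auto
    ultimately show ?thesis by (auto simp: dvd_eq_mod_eq_0)
  qed
  ultimately show ?thesis
    by (simp add: bij_betw_def endo_inj_surj image_subset_iff)
qed

text \<open>Expanding \<open>(2 * r j - k) * (2 * j - k)\<close> leaves only the mixed product
  depending on \<open>h\<close>, because \<open>r\<close> permutes the nonzero residues and so fixes
  the linear sums. With \<open>k = 4 * m + 1\<close> the factor 4 cancels, which leaves the odd
  denominator \<open>k\<^sup>2\<close>.\<close>

lemma dedekind_sum_eq_residue_sum:
  fixes h k m :: int
  assumes "k = 4 * m + 1" "k \<ge> 1" "coprime h k"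
  shows "dedekind_sum h k =
    of_int (residue_sum h k - k * \<Sum>{1..<k} + m * k\<^sup>2) / of_int (k\<^sup>2)"
proof -
  define r where "r j = h * j mod k" for j
  define T where "T = \<Sum>{1..<k}"
  have bij: "bij_betw r {1..<k} {1..<k}"
    unfolding r_def using assms by (intro bij_betw_mult_mod)
  then have sum_r: "(\<Sum>j\<in>{1..<k}. r j) = T"
    unfolding T_def by (rule sum.reindex_bij_betw[where g = "\<lambda>x. x", simplified])
  \<comment> \<open>The term \<open>j = k\<close> drops out, since \<open>sawtooth\<close> vanishes
    at integers.\<close>
  have "dedekind_sum h k = (\<Sum>j\<in>{1..<k}.
      sawtooth (of_int (h * j) / of_int k) * sawtooth (of_int j / of_int k))"
    unfolding dedekind_sum_def using assms
    by (intro sum.mono_neutral_right) (auto simp: sawtooth_def)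
  also have "\<dots> = (\<Sum>j\<in>{1..<k}. of_int ((2 * r j - k) * (2 * j - k)) / of_int (4 * k\<^sup>2))"
  proof (rule sum.cong[OF refl])
    fix j assume j: "j \<in> {1..<k}"
    then have "r j \<in> {1..<k}" using bij by (auto simp: bij_betw_def)
    then have "\<not> k dvd h * j" by (auto simp: r_def)
    moreover have "\<not> k dvd j" using j zdvd_not_zless[of j k] by auto
    ultimately show "sawtooth (of_int (h * j) / of_int k) * sawtooth (of_int j / of_int k) =
        of_int ((2 * r j - k) * (2 * j - k)) / of_int (4 * k\<^sup>2)"
      using j assms(2) sawtooth_of_int_divide[of k "h * j"] sawtooth_of_int_divide[of k j]
      by (simp add: r_def power2_eq_square)
  qed
  also have "\<dots> = of_int (\<Sum>j\<in>{1..<k}. (2 * r j - k) * (2 * j - k)) / of_int (4 * k\<^sup>2)"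
    by (simp add: sum_divide_distrib)
  also have "(\<Sum>j\<in>{1..<k}. (2 * r j - k) * (2 * j - k)) =
      (\<Sum>j\<in>{1..<k}. 4 * (j * r j) - 2 * k * r j - 2 * k * j + k\<^sup>2)"
    by (intro sum.cong) (auto simp: algebra_simps power2_eq_square)
  also have "\<dots> = 4 * residue_sum h k - 2 * k * T - 2 * k * T + (k - 1) * k\<^sup>2"
    using assms(2)
    by (simp add: sum.distrib sum_subtractf sum_r residue_sum_def r_def[symmetric] T_def
        flip: sum_distrib_left)
  also have "\<dots> = 4 * (residue_sum h k - k * T + m * k\<^sup>2)"
    by (simp add: assms(1) algebra_simps)
  also have "(of_int \<dots> :: rat) / of_int (4 * k\<^sup>2) =
      of_int (residue_sum h k - k * T + m * k\<^sup>2) / of_int (k\<^sup>2)"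
    by (simp only: of_int_mult mult_divide_mult_cancel_left)
  finally show ?thesis by (simp only: T_def)
qed

text \<open>Points moved by the involution come in pairs of equal values, which cancel modulo 2. The
  linear order serves only to select one point from each pair.\<close>

lemma even_sum_involution_iff:
  fixes f :: "'a::linorder \<Rightarrow> int"
  assumes "finite A" "\<And>x. x \<in> A \<Longrightarrow> \<sigma> x \<in> A" "\<And>x. x \<in> A \<Longrightarrow> \<sigma> (\<sigma> x) = x"
    and "\<And>x. x \<in> A \<Longrightarrow> f (\<sigma> x) = f x"
  shows "even (sum f A) \<longleftrightarrow> even (sum f {x \<in> A. \<sigma> x = x})"
proof -
  have "sum f A = sum f {x \<in> A. \<sigma> x = x} + sum f {x \<in> A. \<sigma> x \<noteq> x}"
    using assms(1) by (subst sum.union_disjoint[symmetric]) (auto intro!: sum.cong)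
  also have "sum f {x \<in> A. \<sigma> x \<noteq> x} = sum f {x \<in> A. \<sigma> x < x} + sum f {x \<in> A. x < \<sigma> x}"
    using assms(1) by (subst sum.union_disjoint[symmetric]) (auto intro!: sum.cong)
  also have "sum f {x \<in> A. \<sigma> x < x} = sum f {x \<in> A. x < \<sigma> x}"
    using assms by (intro sum.reindex_bij_witness[of _ \<sigma> \<sigma>]) auto
  finally show ?thesis by simp
qed

text \<open>The indices \<open>j\<close> and \<open>k - j\<close> are paired: each pair contributes
  an odd number, and the number of pairs, \<open>2 * m\<close>, is even.\<close>

lemma even_sum_majority:
  fixes h u k m :: int
  assumes "k = 4 * m + 1" "k \<ge> 1" "coprime h k" "coprime u k"
  shows "even (\<Sum>j\<in>{1..<k}. j * (h * j mod k) + j * (u * j mod k) + (h * j mod k) * (u * j mod k))"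
    (is "even (sum ?f _)")
proof -
  have refl_mod: "x * (k - j) mod k = k - x * j mod k" if "coprime x k" "j \<in> {1..<k}" for x j
  proof -
    have "x * j mod k \<in> {1..<k}"
      using bij_betw_mult_mod[OF that(1)] that(2) by (auto simp: bij_betw_def)
    then have "\<not> k dvd x * j" by auto
    moreover have "x * (k - j) = - (x * j) + x * k" by (simp add: right_diff_distrib)
    then have "x * (k - j) mod k = - (x * j) mod k" by (simp only: mod_mult_self1)
    ultimately show ?thesis by (simp add: zmod_zminus1_eq_if dvd_eq_mod_eq_0)
  qed
  have "{1..<k} = {1..2 * m} \<union> {2 * m + 1..<k}" using assms(1,2) by auto
  then have "sum ?f {1..<k} = sum ?f {1..2 * m} + sum ?f {2 * m + 1..<k}"
    by (simp only:) (rule sum.union_disjoint; auto)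
  also have "sum ?f {2 * m + 1..<k} = (\<Sum>j\<in>{1..2 * m}. ?f (k - j))"
    using assms(1) by (intro sum.reindex_bij_witness[of _ "\<lambda>j. k - j" "\<lambda>j. k - j"]) auto
  also have "sum ?f {1..2 * m} + \<dots> = (\<Sum>j\<in>{1..2 * m}. ?f j + ?f (k - j))"
    by (simp add: sum.distrib)
  finally have eq: "sum ?f {1..<k} = (\<Sum>j\<in>{1..2 * m}. ?f j + ?f (k - j))" .
  \<comment> \<open>As \<open>k\<close> is odd, passing to \<open>k - a\<close>,
    \<open>k - b\<close>, \<open>k - c\<close> complements all three bits, and the majority of the
    complements is the complement of the majority.\<close>
  have "odd k" using assms(1) by simp
  then have odd: "odd (a * b + a * c + b * c + ((k - a) * (k - b) + (k - a) * (k - c) + (k - b) * (k - c)))"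
    for a b c by auto
  have "odd (?f j + ?f (k - j))" if "j \<in> {1..2 * m}" for j
  proof -
    have "j \<in> {1..<k}" using that assms(1) by auto
    then show ?thesis
      using odd[of j "h * j mod k" "u * j mod k"] assms(3,4) by (simp only: refl_mod not_False_eq_True)
  qed
  then have "{j \<in> {1..2 * m}. odd (?f j + ?f (k - j))} = {1..2 * m}" by blast
  \<comment> \<open>Here \<open>k\<close> being 1 modulo 4, and not merely odd, is what
    counts.\<close>
  moreover have "even (card {1..2 * m})" by (simp add: nat_mult_distrib)
  ultimately show ?thesis unfolding eq by (simp only: even_sum_iff finite_atLeastAtMost_int)
qed

text \<open>Substituting \<open>u * j mod k\<close> for \<open>j\<close> in
  \<open>residue_sum (h * u) k\<close> turns \<open>h * u * j\<close> into \<open>h * j\<close>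
  modulo \<open>k\<close>, so this sum supplies the third product of the majority function.\<close>

lemma residue_sum_mult_involution:
  fixes h u k m :: int
  assumes "k = 4 * m + 1" "k \<ge> 1" "coprime h k" "[u * u = 1] (mod k)"
  shows "even (residue_sum h k + residue_sum u k + residue_sum (h * u) k)"
proof -
  have "coprime u k" using assms(4) coprime_iff_invertible_int by blast
  have "h * u * (u * j mod k) mod k = h * j mod k" for j
  proof -
    have "[h * u * (u * j mod k) = h * u * (u * j)] (mod k)"
      by (simp add: cong_def mod_mult_right_eq)
    also have "h * u * (u * j) = (u * u) * (h * j)" by (simp add: mult_ac)
    also have "[(u * u) * (h * j) = 1 * (h * j)] (mod k)"
      using assms(4) by (rule cong_scalar_right)
    finally show ?thesis by (simp add: cong_def)
  qed
  then have "residue_sum (h * u) k = (\<Sum>j\<in>{1..<k}. (u * j mod k) * (h * j mod k))"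
    unfolding residue_sum_def
    using sum.reindex_bij_betw[OF bij_betw_mult_mod[OF \<open>coprime u k\<close>],
        of "\<lambda>j. j * (h * u * j mod k)"] by simp
  then show ?thesis
    using even_sum_majority[OF assms(1-3) \<open>coprime u k\<close>]
    by (simp add: residue_sum_def sum.distrib mult.commute)
qed

lemma odd_sum_squares_below:
  fixes p :: int
  assumes "[p = 3] (mod 4)" "p \<ge> 0"
  shows "odd (\<Sum>i\<in>{1..<p}. i * i)"
proof -
  have "p mod 4 = 3" using assms(1) by (simp add: cong_def)
  then obtain n where n: "p = 4 * n + 3" by (metis mult_div_mod_eq)
  \<comment> \<open>The largest odd number below \<open>p\<close> is
    \<open>p - 2 = 4 * n + 1\<close>, hence the bound \<open>2 * n\<close> on
    \<open>t\<close>.\<close>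
  have "{i \<in> {1..<p}. odd (i * i)} = (\<lambda>t. 2 * t + 1) ` {0..2 * n}"
    using n by (auto elim!: oddE)
  then have "card {i \<in> {1..<p}. odd (i * i)} = nat (2 * n + 1)"
    by (simp add: card_image inj_on_def)
  moreover have "odd (nat (2 * n + 1))" using n assms(2) by (simp add: even_nat_iff)
  ultimately show ?thesis by (simp add: even_sum_iff)
qed

lemma odd_residue_sum_involution:
  fixes p q u :: int
  assumes "prime q" "odd q" "[p = 3] (mod 4)" "p > 0" "coprime p q"
    and "[u = 1] (mod p)" "[u = -1] (mod q)"
  shows "odd (residue_sum u (p * q))"
proof -
  define k where "k = p * q"
  have "q > 0" using assms(1) by (simp add: prime_gt_0_int)
  have "k > 0" using \<open>q > 0\<close> assms(4) by (simp add: k_def)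
  have "[u * u = 1 * 1] (mod p)" "[u * u = (-1) * (-1)] (mod q)"
    using assms(6,7) by (intro cong_mult; simp)+
  then have uu: "[u * u = 1] (mod k)"
    using assms(5) by (simp add: k_def coprime_cong_mult)
  then have "coprime u k" using coprime_iff_invertible_int by blast
  have invol: "u * (u * j mod k) mod k = j" if "j \<in> {1..<k}" for j
  proof -
    have "[u * (u * j mod k) = (u * u) * j] (mod k)"
      by (simp add: cong_def mod_mult_right_eq mult.assoc)
    also have "[(u * u) * j = 1 * j] (mod k)"
      using uu by (rule cong_scalar_right)
    finally show ?thesis using that by (simp add: cong_def)
  qed
  have "u * j mod k = j \<longleftrightarrow> q dvd j" if "j \<in> {1..<k}" for j
  proof -
    have "u * j mod k = j \<longleftrightarrow> [u * j = j] (mod k)" using that by (simp add: cong_def)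
    also have "\<dots> \<longleftrightarrow> p * q dvd (u - 1) * j"
      by (simp add: cong_iff_dvd_diff k_def algebra_simps)
    \<comment> \<open>Divisibility by \<open>p\<close> is automatic from \<open>u\<close> being 1
      modulo \<open>p\<close>; modulo \<open>q\<close> the factor \<open>u - 1\<close> is -2, hence
      a unit.\<close>
    also have "\<dots> \<longleftrightarrow> q dvd (u - 1) * j"
      using assms(5,6) by (auto simp: cong_iff_dvd_diff intro: divides_mult dvd_mult_right)
    also have "\<dots> \<longleftrightarrow> q dvd j"
    proof -
      have "\<not> q dvd u - 1"
      proof
        assume "q dvd u - 1"
        moreover have "q dvd u + 1" using assms(7) by (simp add: cong_iff_dvd_diff)
        ultimately have "q dvd 2" using dvd_diff[of q "u + 1" "u - 1"] by simp
        then have "q \<le> 2" by (rule zdvd_imp_le) simp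
        then show False using prime_ge_2_int[OF assms(1)] assms(2) by auto
      qed
      then show ?thesis using assms(1) by (simp add: prime_dvd_mult_iff)
    qed
    finally show ?thesis .
  qed
  then have "{j \<in> {1..<k}. u * j mod k = j} = {j \<in> {1..<k}. q dvd j}" by blast
  also have "\<dots> = (*) q ` {1..<p}"
  proof (intro equalityI subsetI)
    fix j assume j: "j \<in> {j \<in> {1..<k}. q dvd j}"
    then obtain i where i: "j = q * i" by (auto elim: dvdE)
    with j have "0 < q * i" "q * i < q * p" by (auto simp: k_def mult.commute)
    then have "0 < i" "i < p" using \<open>q > 0\<close> by (auto simp: zero_less_mult_iff)
    then show "j \<in> (*) q ` {1..<p}" using i by auto
  next
    fix j assume "j \<in> (*) q ` {1..<p}"
    then obtain i where i: "j = q * i" "0 < i" "i < p" by fastforce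
    then have "0 < q * i" "q * i < q * p" using \<open>q > 0\<close> by auto
    then show "j \<in> {j \<in> {1..<k}. q dvd j}" using i(1) by (simp add: k_def mult.commute)
  qed
  finally have fixpts: "{j \<in> {1..<k}. u * j mod k = j} = (*) q ` {1..<p}" .
  \<comment> \<open>Each summand is the product of \<open>j\<close> and its partner, so it is
    unchanged when the involution swaps them; at a fixed point it is a square.\<close>
  have "even (residue_sum u k) \<longleftrightarrow>
      even (\<Sum>j\<in>{j \<in> {1..<k}. u * j mod k = j}. j * (u * j mod k))"
    unfolding residue_sum_def
    using bij_betw_apply[OF bij_betw_mult_mod[OF \<open>coprime u k\<close>]] invol
    by (intro even_sum_involution_iff) simp_all
  also have "(\<Sum>j\<in>{j \<in> {1..<k}. u * j mod k = j}. j * (u * j mod k)) =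
      (\<Sum>j\<in>{j \<in> {1..<k}. u * j mod k = j}. j * j)"
    by (intro sum.cong) auto
  also have "\<dots> = (\<Sum>i\<in>{1..<p}. (q * i) * (q * i))"
    unfolding fixpts using \<open>q > 0\<close> by (subst sum.reindex) (auto simp: inj_on_def)
  also have "\<dots> = q * q * (\<Sum>i\<in>{1..<p}. i * i)"
    by (simp add: sum_distrib_left mult_ac)
  finally show ?thesis
    using assms(2) odd_sum_squares_below[OF assms(3)] assms(4) by (simp add: k_def)
qed

theorem lemma3:
  fixes p q k \<psi>1 \<psi>2 x1 x2 :: int
  assumes "blum_prime p" and "blum_prime q" and "p \<noteq> q" and "k = p * q"
    and "[\<psi>1 = 1] (mod p)" and "[\<psi>1 = 0] (mod q)"
    and "[\<psi>2 = 0] (mod p)" and "[\<psi>2 = 1] (mod q)"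
    and "gcd x1 k = 1" and "x2 = x1 * (\<psi>1 - \<psi>2)"
  shows "rat_cong2 (dedekind_sum x1 k + dedekind_sum x2 k) 1"
proof -
  define u where "u = \<psi>1 - \<psi>2"
  have p: "prime p" "[p = 3] (mod 4)" and q: "prime q" "[q = 3] (mod 4)"
    using assms(1,2) by (auto simp: blum_prime_def)
  have pos: "p > 0" "q > 0" using p q by (auto simp: prime_gt_0_int)
  then have "k \<ge> 1" using assms(4) by (simp add: int_one_le_iff_zero_less)
  have "odd q" using q(2) by (auto simp: cong_def) presburger
  have "coprime p q" using p(1) q(1) assms(3) by (rule primes_coprime)
  have "[p * q = 3 * 3] (mod 4)" using p(2) q(2) by (rule cong_mult)
  then have "k mod 4 = 1" by (simp add: assms(4) cong_def)
  then obtain m where m: "k = 4 * m + 1" by (metis mult_div_mod_eq)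
  have u: "[u = 1] (mod p)" "[u = -1] (mod q)"
    using cong_diff[OF assms(5,7)] cong_diff[OF assms(6,8)] by (simp_all add: u_def)
  have "[u * u = 1 * 1] (mod p)" "[u * u = (-1) * (-1)] (mod q)"
    using u by (intro cong_mult; simp)+
  then have uu: "[u * u = 1] (mod k)"
    using \<open>coprime p q\<close> by (simp add: assms(4) coprime_cong_mult)
  have "coprime u k" using uu coprime_iff_invertible_int by blast
  have "coprime x1 k" using assms(9) by (simp only: coprime_iff_gcd_eq_1)
  moreover from this have "coprime x2 k"
    using \<open>coprime u k\<close> by (simp add: assms(10) u_def)
  ultimately have cop: "coprime x1 k" "coprime x2 k" .
  have "odd (residue_sum u k)"
    unfolding assms(4) using q(1) \<open>odd q\<close> p(2) pos(1) \<open>coprime p q\<close> u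
    by (rule odd_residue_sum_involution)
  with residue_sum_mult_involution[OF m \<open>k \<ge> 1\<close> cop(1) uu]
  have odd_sum: "odd (residue_sum x1 k + residue_sum x2 k)"
    by (auto simp: assms(10) u_def)
  \<comment> \<open>\<open>N h\<close> is the numerator of the Dedekind sum over
    \<open>k\<^sup>2\<close>. Its last two terms do not involve \<open>h\<close>, so they cancel
    modulo 2 in \<open>N x1 + N x2\<close>; the 1 to be subtracted becomes the odd number
    \<open>k\<^sup>2\<close>.\<close>
  define N where "N h = residue_sum h k - k * \<Sum>{1..<k} + m * k\<^sup>2" for h
  have "odd k" by (simp add: m)
  then have "even (N x1 + N x2 - k\<^sup>2)" using odd_sum by (simp add: N_def)
  then obtain c where c: "N x1 + N x2 - k\<^sup>2 = 2 * c" by (elim evenE)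
  have "dedekind_sum x1 k + dedekind_sum x2 k - 1 = of_int (N x1 + N x2 - k\<^sup>2) / of_int (k\<^sup>2)"
    using dedekind_sum_eq_residue_sum[OF m \<open>k \<ge> 1\<close>] cop \<open>k \<ge> 1\<close>
    by (simp add: N_def[symmetric] add_divide_distrib diff_divide_distrib)
  then have "(dedekind_sum x1 k + dedekind_sum x2 k - 1) / 2 = of_int c / of_int (k\<^sup>2)"
    by (simp add: c)
  moreover have "odd (k\<^sup>2)" using \<open>odd k\<close> by simp
  ultimately show ?thesis unfolding rat_cong2_def by (metis odd_denominator_divideI)
qed

end
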